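(* Any streaming algorithm for \textsc{Diameter} in the AL model that works correctly on a family of graphs containing all "Windmill" graphs $W_N(x,y)$ (for all $N$ and all $x,y \in \{0,1\}^N$) and uses $p$ passes over the stream requires $\Omega(n/p)$ bits of memory, where $n$ is the number of vertices.
   Context: For $N\ge1$ and $x,y\in\{0,1\}^N$, the tree $W_N(x,y)$ on $5N+6$ vertices is built as follows. Take a path on $6$ vertices, one of whose ends is called the center $c$. For each $i \in \{1,\dots,N\}$ add vertices $a_{i,2},a_{i,3},b_{i,1},b_{i,2},b_{i,3}$, write $a_{i,1} := c$, and add the edge $a_{i,3}b_{i,1}$. If $x_i=0$ add edges $a_{i,1}a_{i,2}$ and $a_{i,1}a_{i,3}$; if $x_i = 1$ add edges $a_{i,1}a_{i,2}$ and $a_{i,2}a_{i,3}$. If $y_i = 0$ add edges $b_{i,1}b_{i,2}$ and $b_{i,1}b_{i,3}$; if $y_i=1$ add edges $b_{i,1}b_{i,2}$ and $b_{i,2}b_{i,3}$. \textsc{Diameter}: compute $\max_{s,t} d(s,t)$. In the Adjacency List (AL) streaming model the graph arrives as a sequence of vertices in arbitrary fixed order, each with the full list of its incident edges. A $p$-pass algorithm reads the sequence $p$ times with unlimited computation; memory is in bits. "Requires $\Omega(f)$ bits" means there is a constant $c_0>0$ such that every such algorithm uses at least $c_0 f$ bits on some $n$-vertex input from the family, for all sufficiently large $n$ and all $p$.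
   Formalization: The bound is stated for all n of the form 5N+6 with N ≥ 1, the sizes at which Windmill graphs exist; for other n the family may contain no n-vertex graph, so the claim for all large n fails as written. *)

theory Defs
  imports "Graph_Theory.Pair_Digraph" "Graph_Theory.Shortest_Path"
begin

section \<open>Diameter\<close>

text \<open>
  Finite simple undirected graphs are taken from the locale \<^locale>\<open>pair_graph\<close>: every
  undirected edge is a pair of opposite arcs. The distance is the unit-weight shortest-path
  distance, which is infinite between different components.
\<close>

definition dist_graph :: "'a pair_pre_digraph \<Rightarrow> 'a \<Rightarrow> 'a \<Rightarrow> ereal" where
  "dist_graph G s t = wf_digraph.\<mu> (with_proj G) (\<lambda>_. 1) s t"

definition diameter :: "'a pair_pre_digraph \<Rightarrow> ereal" where
  "diameter G = Max {dist_graph G s t | s t. s \<in> pverts G \<and> t \<in> pverts G}"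


section \<open>Windmill graphs\<close>

text \<open>
  Vertices are numbered without gaps: the initial path is 0, 1, 2, 3, 4, 5 with center 0, and
  block \<open>i \<ge> 1\<close> owns the numbers \<open>5 * i + 1, \<dots>, 5 * i + 5\<close>, in the order
  \<open>a i 2, a i 3, b i 1, b i 2, b i 3\<close>. The numbering does not depend on \<open>x\<close> and \<open>y\<close>.
\<close>

definition wm_a :: "nat \<Rightarrow> nat \<Rightarrow> nat" where
  "wm_a i k = (if k = 1 then 0 else 5 * i + k - 1)"

definition wm_b :: "nat \<Rightarrow> nat \<Rightarrow> nat" where
  "wm_b i k = 5 * i + 2 + k"

definition wm_verts :: "nat \<Rightarrow> nat set" where
  "wm_verts N = {0..5} \<union>
     (\<Union>i\<in>{1..N}. {wm_a i 2, wm_a i 3, wm_b i 1, wm_b i 2, wm_b i 3})"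

text \<open>
  A string in \<open>{0,1}\<^sup>N\<close> is a function of type \<^typ>\<open>nat \<Rightarrow> bool\<close> (\<^term>\<open>True\<close> for 1) of which
  only the values on \<open>{1..N}\<close> are used.
\<close>

definition wm_edges :: "nat \<Rightarrow> (nat \<Rightarrow> bool) \<Rightarrow> (nat \<Rightarrow> bool) \<Rightarrow> nat rel" where
  "wm_edges N x y =
     {(0,1), (1,2), (2,3), (3,4), (4,5)} \<union>
     (\<Union>i\<in>{1..N}.
        {(wm_a i 3, wm_b i 1)} \<union>
        (if x i then {(wm_a i 1, wm_a i 2), (wm_a i 2, wm_a i 3)}
                else {(wm_a i 1, wm_a i 2), (wm_a i 1, wm_a i 3)}) \<union>
        (if y i then {(wm_b i 1, wm_b i 2), (wm_b i 2, wm_b i 3)}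
                else {(wm_b i 1, wm_b i 2), (wm_b i 1, wm_b i 3)}))"

definition windmill :: "nat \<Rightarrow> (nat \<Rightarrow> bool) \<Rightarrow> (nat \<Rightarrow> bool) \<Rightarrow> nat pair_pre_digraph" where
  "windmill N x y = \<lparr>pverts = wm_verts N, parcs = wm_edges N x y \<union> (wm_edges N x y)\<inverse>\<rparr>"

lemma wm_verts_eq: "wm_verts N = {..<5 * N + 6}"
proof (rule set_eqI)
  fix v
  have "v \<in> wm_verts N" if v: "v < 5 * N + 6"
  proof (cases "v \<le> 5")
    case False
    define i r where "i = (v - 1) div 5" and "r = (v - 1) mod 5"
    have vir: "v = 5 * i + r + 1" using False by (simp add: i_def r_def)
    have "r < 5" by (simp add: r_def)
    then have "r = 0 \<or> r = 1 \<or> r = 2 \<or> r = 3 \<or> r = 4" by linarith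
    then have "v \<in> {wm_a i 2, wm_a i 3, wm_b i 1, wm_b i 2, wm_b i 3}"
      by (elim disjE) (simp_all add: vir wm_a_def wm_b_def)
    moreover have "i \<in> {1..N}" using v False vir \<open>r < 5\<close> by simp
    ultimately show ?thesis unfolding wm_verts_def by blast
  qed (simp add: wm_verts_def)
  moreover have "v < 5 * N + 6" if "v \<in> wm_verts N"
    using that by (auto simp: wm_verts_def wm_a_def wm_b_def)
  ultimately show "v \<in> wm_verts N \<longleftrightarrow> v \<in> {..<5 * N + 6}" by auto
qed

lemma wm_edges_less:
  assumes "(u, v) \<in> wm_edges N x y" shows "u < v" and "v < 5 * N + 6"
  using assms by (auto simp: wm_edges_def wm_a_def wm_b_def split: if_splits)

lemma pair_graph_windmill: "pair_graph (windmill N x y)"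
proof -
  let ?E = "parcs (windmill N x y)"
  have *: "fst e < 5 * N + 6 \<and> snd e < 5 * N + 6 \<and> fst e \<noteq> snd e" if "e \<in> ?E" for e
    using that wm_edges_less[of "fst e" "snd e" N x y] wm_edges_less[of "snd e" "fst e" N x y]
    by (cases e) (auto simp: windmill_def)
  then have "?E \<subseteq> {..<5 * N + 6} \<times> {..<5 * N + 6}" by auto
  then have fin: "finite ?E" by (rule finite_subset) simp
  have V: "pverts (windmill N x y) = {..<5 * N + 6}" by (simp add: windmill_def wm_verts_eq)
  have "symmetric (windmill N x y)"
    unfolding symmetric_def with_proj_simps by (auto simp: windmill_def sym_def)
  then show ?thesis by unfold_locales (simp_all add: V fin *)
qed


section \<open>Multi-pass algorithms in the Adjacency List model\<close>

text \<open>
  A stream item is a vertex together with the list of its incident edges, each given by the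
  other endpoint.
\<close>

type_synonym item = "nat \<times> nat list"

definition al_stream :: "nat pair_pre_digraph \<Rightarrow> item list \<Rightarrow> bool" where
  "al_stream G \<sigma> \<longleftrightarrow>
     distinct (map fst \<sigma>) \<and> set (map fst \<sigma>) = pverts G \<and>
     (\<forall>(v, ns) \<in> set \<sigma>. distinct ns \<and> set ns = {w. (v, w) \<in> parcs G})"

text \<open>
  The memory content is a bit string, updated by an arbitrary function whenever an item arrives.
  The number \<open>n\<close> of vertices and the number \<open>t\<close> of items read so far (which determines the
  current pass and the position in it) are passed to the algorithm free of charge; they
  are not counted as memory. Giving up this help only restricts the class of algorithms.
\<close>

record al_algorithm =
  init :: "nat \<Rightarrow> bool list"
  step :: "nat \<Rightarrow> nat \<Rightarrow> item \<Rightarrow> bool list \<Rightarrow> bool list"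
  result :: "nat \<Rightarrow> bool list \<Rightarrow> ereal"

primrec mem_after :: "al_algorithm \<Rightarrow> item list \<Rightarrow> nat \<Rightarrow> bool list" where
  "mem_after A \<sigma> 0 = init A (length \<sigma>)"
| "mem_after A \<sigma> (Suc t) = step A (length \<sigma>) t (\<sigma> ! (t mod length \<sigma>)) (mem_after A \<sigma> t)"

definition al_output :: "al_algorithm \<Rightarrow> nat \<Rightarrow> item list \<Rightarrow> ereal" where
  "al_output A p \<sigma> = result A (length \<sigma>) (mem_after A \<sigma> (p * length \<sigma>))"

definition memory_bits :: "al_algorithm \<Rightarrow> nat \<Rightarrow> item list \<Rightarrow> nat" where
  "memory_bits A p \<sigma> = Max ((\<lambda>t. length (mem_after A \<sigma> t)) ` {0..p * length \<sigma>})"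

definition solves_diameter :: "al_algorithm \<Rightarrow> nat \<Rightarrow> nat pair_pre_digraph set \<Rightarrow> bool" where
  "solves_diameter A p F \<longleftrightarrow>
     (\<forall>G\<in>F. \<forall>\<sigma>. al_stream G \<sigma> \<longrightarrow> al_output A p \<sigma> = diameter G)"

end

theory Submission
  imports Defs
begin

text \<open>
  Hanging the windmill at its center, block \<open>i\<close> has depth \<open>3 + x\<^sub>i + y\<^sub>i\<close> and the initial path has
  depth 5, so the diameter reaches 10 exactly if \<open>x\<^sub>i = y\<^sub>i = 1\<close> for some \<open>i\<close>. The adjacency lists
  of the initial path and of the \<open>a\<close>-vertices \<open>a i 2\<close>, \<open>a i 3\<close> depend only on \<open>x\<close>, those of the
  \<open>b\<close>-vertices only on \<open>y\<close>. Present the former first. The memory contents at the \<open>2p\<close> moments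
  at which the stream switches between the two kinds then form the transcript of a deterministic
  protocol for disjointness, and the pairs \<open>(S, - S)\<close> are a fooling set: if \<open>(S, - S)\<close> and
  \<open>(T, - T)\<close> had the same transcript, so would \<open>(S, - T)\<close> and \<open>(T, - S)\<close>, one of which is
  intersecting. Hence there are at least \<open>2\<^sup>N\<close> transcripts. As \<open>s\<close> bits of memory allow for
  at most \<open>4\<^sup>s\<close> memory contents, \<open>N \<le> 4ps\<close>.
\<close>

section \<open>Distances\<close>

text \<open>Upper bounds on distances are obtained from relation powers, which compose more easily
  than \<open>awalk\<close>s; membership of \<open>u\<close> covers the empty walk.\<close>

lemma dist_graph_le_relpow:
  assumes G: "pair_graph G" and u: "u \<in> pverts G" and uv: "(u, v) \<in> parcs G ^^ k"
  shows "dist_graph G u v \<le> ereal k"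
proof -
  interpret pair_graph G by (fact G)
  have "\<exists>p. awalk u p v \<and> length p = k" using u uv
  proof (induction k arbitrary: u)
    case (Suc k)
    then obtain w where w: "(u, w) \<in> parcs G" "(w, v) \<in> parcs G ^^ k"
      by (meson relpow_Suc_E2)
    moreover from w(1) have "w \<in> pverts G" by (metis in_arcsD2)
    ultimately obtain p where "awalk w p v" "length p = k" using Suc.IH by blast
    with w show ?case by (intro exI[of _ "(u, w) # p"]) (simp add: awalk_Cons_iff)
  qed (auto simp: awalk_Nil_iff)
  then obtain p where p: "awalk u p v" "length p = k" by blast
  then show ?thesis
    using min_cost_le_walk_cost[OF p(1), of "\<lambda>_. 1"]
    by (simp add: dist_graph_def awalk_cost_def sum_list_triv)
qed

text \<open>A potential that rises by at most one per arc rises by at most the length along any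
  walk. Since the distance is an infimum over walks, such a potential certifies a lower bound, also
  when no walk exists.\<close>

lemma dist_graph_ge_Lipschitz:
  fixes h :: "'a \<Rightarrow> int"
  assumes G: "pair_graph G" and h: "\<And>a b. (a, b) \<in> parcs G \<Longrightarrow> h b - h a \<le> 1"
  shows "ereal (h v - h u) \<le> dist_graph G u v"
proof -
  interpret pair_graph G by (fact G)
  have "h v - h u \<le> int (length p)" if "awalk u p v" for p
    using that
  proof (induction p arbitrary: u)
    case (Cons e p)
    then have e: "e \<in> parcs G" "u = fst e" and IH: "h v - h (snd e) \<le> int (length p)"
      by (auto simp: awalk_Cons_iff)
    have "h (snd e) - h (fst e) \<le> 1" using h[of "fst e" "snd e"] e by simp
    with IH e show ?case by simp
  qed (auto simp: awalk_Nil_iff)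
  then show ?thesis
    unfolding dist_graph_def \<mu>_def
    by (intro INF_greatest) (force simp: awalk_cost_def sum_list_triv)
qed

lemma diameter_le:
  assumes "pair_graph G" "pverts G \<noteq> {}"
    and "\<And>s t. s \<in> pverts G \<Longrightarrow> t \<in> pverts G \<Longrightarrow> dist_graph G s t \<le> d"
  shows "diameter G \<le> d"
proof -
  interpret pair_graph G by fact
  have "{dist_graph G s t | s t. s \<in> pverts G \<and> t \<in> pverts G}
      = (\<lambda>(s, t). dist_graph G s t) ` (pverts G \<times> pverts G)" by auto
  then show ?thesis using assms unfolding diameter_def by (auto simp: pair_finite_verts)
qed

lemma diameter_ge:
  assumes "pair_graph G" "s \<in> pverts G" "t \<in> pverts G"
  shows "dist_graph G s t \<le> diameter G"
proof -
  interpret pair_graph G by fact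
  have "{dist_graph G s t | s t. s \<in> pverts G \<and> t \<in> pverts G}
      = (\<lambda>(s, t). dist_graph G s t) ` (pverts G \<times> pverts G)" by auto
  then have "finite {dist_graph G s t | s t. s \<in> pverts G \<and> t \<in> pverts G}" by simp
  then show ?thesis using assms(2,3) unfolding diameter_def by (intro Max_ge) blast+
qed

lemma sym_relpow: "sym r \<Longrightarrow> (u, v) \<in> r ^^ k \<Longrightarrow> (v, u) \<in> r ^^ k"
proof (induction k arbitrary: v)
  case (Suc k)
  then obtain w where "(u, w) \<in> r ^^ k" "(w, v) \<in> r" by auto
  with Suc show ?case by (meson relpow_Suc_I2 symD)
qed simp


section \<open>The diameter of windmills\<close>

text \<open>Closed form of the distance from the center; \<open>r\<close> is the position of the
  vertex inside its block.\<close>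

definition depth :: "(nat \<Rightarrow> bool) \<Rightarrow> (nat \<Rightarrow> bool) \<Rightarrow> nat \<Rightarrow> nat" where
  "depth x y v = (if v \<le> 5 then v else
     let i = (v - 1) div 5; r = (v - 1) mod 5 in
     if r = 0 then 1 else
     if r = 4 then 3 + of_bool (x i) + of_bool (y i) else r + of_bool (x i))"

lemma depth_path: "v \<le> 5 \<Longrightarrow> depth x y v = v"
  by (simp add: depth_def)

lemma depth_block:
  assumes "i \<in> {1..N}"
  shows "depth x y (wm_a i 2) = 1"
    and "depth x y (wm_a i 3) = 1 + of_bool (x i)"
    and "depth x y (wm_b i 1) = 2 + of_bool (x i)"
    and "depth x y (wm_b i 2) = 3 + of_bool (x i)"
    and "depth x y (wm_b i 3) = 3 + of_bool (x i) + of_bool (y i)"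
proof -
  have "(5 * i + r) div 5 = i" "(5 * i + r) mod 5 = r" if "r < 5" for r
    using that by auto
  note this[of 0] this[of 1] this[of 2] this[of 3] this[of 4]
  then show "depth x y (wm_a i 2) = 1"
    and "depth x y (wm_a i 3) = 1 + of_bool (x i)"
    and "depth x y (wm_b i 1) = 2 + of_bool (x i)"
    and "depth x y (wm_b i 2) = 3 + of_bool (x i)"
    and "depth x y (wm_b i 3) = 3 + of_bool (x i) + of_bool (y i)"
    using assms by (simp_all add: depth_def Let_def wm_a_def wm_b_def)
qed

lemma wm_edges_cases:
  assumes "(u, v) \<in> wm_edges N x y"
  obtains (path) "(u, v) \<in> {(0, 1), (1, 2), (2, 3), (3, 4), (4, 5)}"
    | (mid) i where "i \<in> {1..N}" "u = wm_a i 3" "v = wm_b i 1"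
    | (a) i where "i \<in> {1..N}" "(u, v) \<in>
        (if x i then {(wm_a i 1, wm_a i 2), (wm_a i 2, wm_a i 3)}
                else {(wm_a i 1, wm_a i 2), (wm_a i 1, wm_a i 3)})"
    | (b) i where "i \<in> {1..N}" "(u, v) \<in>
        (if y i then {(wm_b i 1, wm_b i 2), (wm_b i 2, wm_b i 3)}
                else {(wm_b i 1, wm_b i 2), (wm_b i 1, wm_b i 3)})"
  using assms unfolding wm_edges_def by blast

lemma wm_a_1: "wm_a i (Suc 0) = 0"
  by (simp add: wm_a_def)

text \<open>Every pair in \<open>wm_edges\<close> points away from the center. This yields both the
  walks from the center and the potential for the lower bound.\<close>

lemma depth_edge:
  assumes "(u, v) \<in> wm_edges N x y"
  shows "depth x y v = Suc (depth x y u)"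
  using assms
proof (cases rule: wm_edges_cases)
  case path
  then show ?thesis by (auto simp: depth_path)
next
  case (mid i)
  then show ?thesis using depth_block[OF mid(1), of x y] by simp
next
  case (a i)
  then show ?thesis
    using depth_block[OF a(1), of x y] depth_path[of 0 x y] by (auto simp: wm_a_1 split: if_splits)
next
  case (b i)
  then show ?thesis using depth_block[OF b(1), of x y] by (auto split: if_splits)
qed

lemma block_cases:
  assumes "v < 5 * N + 6" "5 < v"
  obtains i where "i \<in> {1..N}" "v \<in> {wm_a i 2, wm_a i 3, wm_b i 1, wm_b i 2, wm_b i 3}"
proof -
  have "v \<in> wm_verts N" using assms(1) by (simp add: wm_verts_eq)
  with assms(2) that show thesis unfolding wm_verts_def by fastforce
qed

lemma ex_parent:
  assumes "v < 5 * N + 6" "v \<noteq> 0"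
  shows "\<exists>u. (u, v) \<in> wm_edges N x y"
proof (cases "v \<le> 5")
  case True
  with assms(2) have "v = 1 \<or> v = 2 \<or> v = 3 \<or> v = 4 \<or> v = 5" by linarith
  then have "\<exists>u. (u, v) \<in> {(0, 1), (1, 2), (2, 3), (3, 4), (4, 5)}" by blast
  then show ?thesis unfolding wm_edges_def by blast
next
  case False
  then obtain i where i: "i \<in> {1..N}"
      "v \<in> {wm_a i 2, wm_a i 3, wm_b i 1, wm_b i 2, wm_b i 3}"
    using block_cases[OF assms(1)] by (metis not_le)
  \<comment> \<open>Restricting to the edges of one block leaves four cases, given by its two
    bits.\<close>
  let ?B = "{(wm_a i 3, wm_b i 1)} \<union>
        (if x i then {(wm_a i 1, wm_a i 2), (wm_a i 2, wm_a i 3)}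
                else {(wm_a i 1, wm_a i 2), (wm_a i 1, wm_a i 3)}) \<union>
        (if y i then {(wm_b i 1, wm_b i 2), (wm_b i 2, wm_b i 3)}
                else {(wm_b i 1, wm_b i 2), (wm_b i 1, wm_b i 3)})"
  have "?B \<subseteq> wm_edges N x y" using i(1) unfolding wm_edges_def by blast
  moreover have "\<exists>u. (u, v) \<in> ?B"
    using i(2) by (cases "x i"; cases "y i"; simp only: if_True if_False; blast)
  ultimately show ?thesis by blast
qed

text \<open>Parents have smaller numbers by \<open>wm_edges_less\<close>, so strong induction on the
  number climbs to the center.\<close>

lemma relpow_depth:
  assumes "v < 5 * N + 6"
  shows "(0, v) \<in> parcs (windmill N x y) ^^ depth x y v"
  using assms
proof (induction v rule: less_induct)
  case (less v)
  show ?case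
  proof (cases "v = 0")
    case False
    then obtain u where u: "(u, v) \<in> wm_edges N x y" using ex_parent less.prems by blast
    note wm_edges_less[OF u]
    then have "(0, u) \<in> parcs (windmill N x y) ^^ depth x y u"
      using less.IH by simp
    moreover have "(u, v) \<in> parcs (windmill N x y)" using u by (simp add: windmill_def)
    ultimately show ?thesis unfolding depth_edge[OF u] by (rule relpow_Suc_I)
  qed (simp add: depth_path)
qed

lemma pverts_windmill: "pverts (windmill N x y) = {..<5 * N + 6}"
  by (simp add: windmill_def wm_verts_eq)

text \<open>The walk goes from \<open>u\<close> up to the center and down to
  \<open>v\<close>.\<close>

lemma dist_windmill_le:
  assumes "u < 5 * N + 6" "v < 5 * N + 6"
  shows "dist_graph (windmill N x y) u v \<le> ereal (real (depth x y u + depth x y v))"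
proof -
  have "sym (parcs (windmill N x y))" by (auto simp: windmill_def sym_def)
  then have "(u, 0) \<in> parcs (windmill N x y) ^^ depth x y u"
    using relpow_depth[OF assms(1)] by (rule sym_relpow)
  then have "(u, v) \<in> parcs (windmill N x y) ^^ (depth x y u + depth x y v)"
    using relpow_depth[OF assms(2), of x y] by (auto simp: relpow_add)
  then show ?thesis
    using assms(1) by (intro dist_graph_le_relpow[OF pair_graph_windmill]) (simp_all add: pverts_windmill)
qed

text \<open>Without a common 1, vertex 5 is the only vertex of depth 5, so two distinct vertices
  have depths adding up to at most 5 + 4.\<close>

lemma diameter_windmill_le:
  assumes disj: "\<And>i. i \<in> {1..N} \<Longrightarrow> \<not> (x i \<and> y i)"
  shows "diameter (windmill N x y) \<le> 9"
proof (rule diameter_le[OF pair_graph_windmill])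
  have depth: "depth x y v \<le> (if v = 5 then 5 else 4)" if "v < 5 * N + 6" for v
  proof (cases "5 < v")
    case True
    with that obtain i where i: "i \<in> {1..N}"
        "v \<in> {wm_a i 2, wm_a i 3, wm_b i 1, wm_b i 2, wm_b i 3}"
      by (rule block_cases)
    then have "depth x y v \<le> 3 + of_bool (x i) + of_bool (y i)"
      using depth_block[OF i(1), of x y] by (elim insertE emptyE) simp_all
    also have "\<dots> \<le> 4" using disj[OF i(1)] by auto
    finally show ?thesis using True by simp
  qed (auto simp: depth_path)
  fix s t
  assume "s \<in> pverts (windmill N x y)" "t \<in> pverts (windmill N x y)"
  then have st: "s < 5 * N + 6" "t < 5 * N + 6" by (simp_all add: pverts_windmill)
  show "dist_graph (windmill N x y) s t \<le> 9"
  \<comment> \<open>The detour through the center would give 10 for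
    \<open>s = t = 5\<close>.\<close>
  proof (cases "s = t")
    case True
    then have "dist_graph (windmill N x y) s t \<le> ereal (real 0)"
      using st by (intro dist_graph_le_relpow[OF pair_graph_windmill]) (simp_all add: pverts_windmill)
    then show ?thesis by (rule order_trans) simp
  next
    case False
    then have "depth x y s + depth x y t \<le> 9"
      using depth[OF st(1)] depth[OF st(2)] by (auto split: if_splits)
    then have "ereal (real (depth x y s + depth x y t)) \<le> 9"
      by (metis ereal_less_eq(3) numeral_eq_ereal of_nat_le_iff of_nat_numeral)
    with dist_windmill_le[OF st] show ?thesis by (rule order_trans)
  qed
qed (auto simp: pverts_windmill lessThan_empty_iff)

lemma diameter_windmill_ge:
  assumes i: "i \<in> {1..N}" and "x i" "y i"
  shows "10 \<le> diameter (windmill N x y)"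
proof -
  \<comment> \<open>Depth with the sign reversed on the initial path: \<open>h\<close> runs from -5
    at the end of that path through 0 at the center to 5 at \<open>wm_b i 3\<close>.\<close>
  define h where "h v = (if v \<le> 5 then - int v else int (depth x y v))" for v
  have "\<bar>h v - h u\<bar> \<le> 1" if "(u, v) \<in> wm_edges N x y" for u v
  proof (cases "v \<le> 5")
    case True
    then show ?thesis
      using depth_edge[OF that] wm_edges_less[OF that] by (simp add: h_def depth_path)
  next
    case False
    \<comment> \<open>The initial path meets the blocks only at the center, where both signs
      agree.\<close>
    have "u = 0 \<or> 5 < u"
      using that
    proof (cases rule: wm_edges_cases)
      case path
      then show ?thesis using False by auto
    next
      case (mid i)
      then show ?thesis by (simp add: wm_a_def)
    next
      case (a i)
      then show ?thesis by (auto simp: wm_a_def split: if_splits)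
    next
      case (b i)
      then show ?thesis by (auto simp: wm_b_def split: if_splits)
    qed
    then show ?thesis
      using depth_edge[OF that] False by (auto simp: h_def depth_path)
  qed
  then have "h b - h a \<le> 1" if "(a, b) \<in> parcs (windmill N x y)" for a b
    using that by (fastforce simp: windmill_def)
  then have "ereal (h (wm_b i 3) - h 5) \<le> dist_graph (windmill N x y) 5 (wm_b i 3)"
    by (rule dist_graph_ge_Lipschitz[OF pair_graph_windmill])
  also have "\<dots> \<le> diameter (windmill N x y)"
    using i by (intro diameter_ge[OF pair_graph_windmill]) (simp_all add: pverts_windmill wm_b_def)
  also have "h (wm_b i 3) - h 5 = 10"
    using assms depth_block(5)[OF i, of x y] by (simp add: h_def wm_b_def)
  finally show ?thesis by simp
qed


section \<open>Streams that separate the two inputs\<close>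

definition b_vertex :: "nat \<Rightarrow> bool" where
  "b_vertex v \<longleftrightarrow> 5 < v \<and> 2 \<le> (v - 1) mod 5"

lemma b_vertex_block:
  assumes "i \<in> {1..N}"
  shows "\<not> b_vertex (wm_a i 1)" "\<not> b_vertex (wm_a i 2)" "\<not> b_vertex (wm_a i 3)"
    and "b_vertex (wm_b i 1)" "b_vertex (wm_b i 2)" "b_vertex (wm_b i 3)"
proof -
  have "(5 * i + r) mod 5 = r" if "r < 5" for r
    using that by auto
  note this[of 0] this[of 1] this[of 2] this[of 3] this[of 4]
  then show "\<not> b_vertex (wm_a i 1)" "\<not> b_vertex (wm_a i 2)" "\<not> b_vertex (wm_a i 3)"
    and "b_vertex (wm_b i 1)" "b_vertex (wm_b i 2)" "b_vertex (wm_b i 3)"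
    using assms by (simp_all add: b_vertex_def wm_a_def wm_b_def)
qed

text \<open>Edges governed by \<open>x\<close> avoid all \<open>b\<close>-vertices, edges governed
  by \<open>y\<close> join two of them, and the remaining edges are always present.\<close>

lemma wm_edges_change:
  assumes "(u, v) \<in> wm_edges N x y"
  shows "\<not> b_vertex u \<or> \<not> b_vertex v \<Longrightarrow> (u, v) \<in> wm_edges N x y'"
    and "b_vertex u \<or> b_vertex v \<Longrightarrow> (u, v) \<in> wm_edges N x' y"
proof -
  have "((u, v) \<in> wm_edges N x y' \<or> b_vertex u \<and> b_vertex v)
      \<and> ((u, v) \<in> wm_edges N x' y \<or> \<not> b_vertex u \<and> \<not> b_vertex v)"
    using assms
  proof (cases rule: wm_edges_cases)
    case path
    then show ?thesis unfolding wm_edges_def by blast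
  next
    case mid
    then show ?thesis unfolding wm_edges_def by blast
  next
    case (a i)
    then have "\<not> b_vertex u \<and> \<not> b_vertex v"
      using b_vertex_block[OF a(1)] by (auto split: if_splits)
    moreover have "(u, v) \<in> wm_edges N x y'" using a unfolding wm_edges_def by blast
    ultimately show ?thesis by blast
  next
    case (b i)
    then have "b_vertex u \<and> b_vertex v"
      using b_vertex_block[OF b(1)] by (auto split: if_splits)
    moreover have "(u, v) \<in> wm_edges N x' y" using b unfolding wm_edges_def by blast
    ultimately show ?thesis by blast
  qed
  then show "\<not> b_vertex u \<or> \<not> b_vertex v \<Longrightarrow> (u, v) \<in> wm_edges N x y'"
    and "b_vertex u \<or> b_vertex v \<Longrightarrow> (u, v) \<in> wm_edges N x' y" by blast+
qed

text \<open>Sorting fixes one order, so equal neighborhoods give equal items.\<close>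

definition wm_item :: "nat \<Rightarrow> (nat \<Rightarrow> bool) \<Rightarrow> (nat \<Rightarrow> bool) \<Rightarrow> nat \<Rightarrow> item" where
  "wm_item N x y v = (v, sorted_list_of_set {w. (v, w) \<in> parcs (windmill N x y)})"

lemma wm_item_cong:
  shows "\<not> b_vertex v \<Longrightarrow> wm_item N x y v = wm_item N x y' v"
    and "b_vertex v \<Longrightarrow> wm_item N x y v = wm_item N x' y v"
proof -
  assume "\<not> b_vertex v"
  then have "(v, w) \<in> parcs (windmill N x y) \<longleftrightarrow> (v, w) \<in> parcs (windmill N x y')" for w
    by (auto simp: windmill_def dest: wm_edges_change(1))
  then show "wm_item N x y v = wm_item N x y' v" by (simp add: wm_item_def)
next
  assume "b_vertex v"
  then have "(v, w) \<in> parcs (windmill N x y) \<longleftrightarrow> (v, w) \<in> parcs (windmill N x' y)" for w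
    by (auto simp: windmill_def dest: wm_edges_change(2))
  then show "wm_item N x y v = wm_item N x' y v" by (simp add: wm_item_def)
qed

text \<open>The constant \<open>False\<close> is a placeholder for \<open>y\<close>: by
  \<open>wm_item_cong\<close>, these items are the same for every \<open>y\<close>. The length does
  not depend on \<open>x\<close>.\<close>

definition a_items :: "nat \<Rightarrow> (nat \<Rightarrow> bool) \<Rightarrow> item list" where
  "a_items N x = map (wm_item N x (\<lambda>_. False)) (filter (\<lambda>v. \<not> b_vertex v) [0..<5 * N + 6])"

definition b_items :: "nat \<Rightarrow> (nat \<Rightarrow> bool) \<Rightarrow> item list" where
  "b_items N y = map (wm_item N (\<lambda>_. False) y) (filter b_vertex [0..<5 * N + 6])"

lemma al_stream_windmill: "al_stream (windmill N x y) (a_items N x @ b_items N y)"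
proof -
  interpret pair_graph "windmill N x y" by (rule pair_graph_windmill)
  have "a_items N x = map (wm_item N x y) (filter (\<lambda>v. \<not> b_vertex v) [0..<5 * N + 6])"
    unfolding a_items_def by (intro map_cong refl wm_item_cong(1)) simp
  moreover have "b_items N y = map (wm_item N x y) (filter b_vertex [0..<5 * N + 6])"
    unfolding b_items_def by (intro map_cong refl wm_item_cong(2)) simp
  ultimately have eq: "a_items N x @ b_items N y = map (wm_item N x y)
      (filter (\<lambda>v. \<not> b_vertex v) [0..<5 * N + 6] @ filter b_vertex [0..<5 * N + 6])"
    by simp
  have fst: "fst \<circ> wm_item N x y = id" by (auto simp: wm_item_def)
  have "finite {w. (v, w) \<in> parcs (windmill N x y)}" for v
    using finite_imageI[OF pair_finite_arcs, of snd]
    by (rule finite_subset[rotated]) force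
  then show ?thesis
    unfolding eq al_stream_def by (auto simp: pverts_windmill fst wm_item_def)
qed


section \<open>Fooling a streaming algorithm\<close>

lemma mem_after_segment:
  assumes "length \<sigma> = length \<sigma>'" "mem_after A \<sigma> t = mem_after A \<sigma>' t"
    and "\<And>j. j < k \<Longrightarrow> \<sigma> ! ((t + j) mod length \<sigma>) = \<sigma>' ! ((t + j) mod length \<sigma>)"
  shows "mem_after A \<sigma> (t + k) = mem_after A \<sigma>' (t + k)"
  using assms(3) by (induction k) (simp_all add: assms(1,2))

text \<open>First the contents at the middle of each pass, then those at the end of each pass. The
  initial content depends only on the length of the stream.\<close>

definition transcript :: "al_algorithm \<Rightarrow> nat \<Rightarrow> item list \<Rightarrow> item list \<Rightarrow> bool list list" where
  "transcript A p \<alpha> \<beta> = (let \<sigma> = \<alpha> @ \<beta> in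
     map (\<lambda>k. mem_after A \<sigma> (k * length \<sigma> + length \<alpha>)) [0..<p] @
     map (\<lambda>k. mem_after A \<sigma> (Suc k * length \<sigma>)) [0..<p])"

text \<open>The mixed run imitates the run on \<open>\<alpha> @ \<beta>\<close> while reading
  \<open>\<alpha>\<close>, and the run on \<open>\<alpha>' @ \<beta>'\<close> while reading
  \<open>\<beta>'\<close>. Equal transcripts allow changing the model at every switch.\<close>

lemma transcript_crossover:
  assumes len: "length \<alpha>' = length \<alpha>" "length \<beta>' = length \<beta>"
    and tr: "transcript A p \<alpha> \<beta> = transcript A p \<alpha>' \<beta>'"
  shows "al_output A p (\<alpha> @ \<beta>') = al_output A p (\<alpha> @ \<beta>)"
proof -
  define n where "n = length \<alpha> + length \<beta>"
  let ?m = "\<lambda>\<alpha> \<beta>. mem_after A (\<alpha> @ \<beta>)"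
  have mid: "?m \<alpha> \<beta> (k * n + length \<alpha>) = ?m \<alpha>' \<beta>' (k * n + length \<alpha>)"
    and fin: "?m \<alpha> \<beta> (Suc k * n) = ?m \<alpha>' \<beta>' (Suc k * n)" if "k < p" for k
    using tr that len by (auto simp: transcript_def n_def Let_def map_eq_conv)
  have "k \<le> p \<Longrightarrow> ?m \<alpha> \<beta>' (k * n) = ?m \<alpha> \<beta> (k * n)" for k
  proof (induction k)
    case (Suc k)
    have "?m \<alpha> \<beta>' (k * n + length \<alpha>) = ?m \<alpha> \<beta> (k * n + length \<alpha>)"
      by (rule mem_after_segment) (use Suc len in \<open>auto simp: n_def nth_append\<close>)
    \<comment> \<open>Here the comparison passes to the primed run; \<open>fin\<close> brings it
      back at the end of the pass.\<close>
    with mid Suc.prems have "?m \<alpha> \<beta>' (k * n + length \<alpha>) = ?m \<alpha>' \<beta>' (k * n + length \<alpha>)" by simp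
    then have "?m \<alpha> \<beta>' ((k * n + length \<alpha>) + length \<beta>) = ?m \<alpha>' \<beta>' ((k * n + length \<alpha>) + length \<beta>)"
    proof (rule mem_after_segment[rotated])
      fix j assume "j < length \<beta>"
      then have "(k * n + length \<alpha> + j) mod n = length \<alpha> + j"
        by (metis add.assoc add_strict_left_mono mod_less mod_mult_self3 n_def)
      then show "(\<alpha> @ \<beta>') ! ((k * n + length \<alpha> + j) mod length (\<alpha> @ \<beta>'))
          = (\<alpha>' @ \<beta>') ! ((k * n + length \<alpha> + j) mod length (\<alpha> @ \<beta>'))"
        using len by (simp add: n_def nth_append)
    qed (simp add: len)
    then have "?m \<alpha> \<beta>' (Suc k * n) = ?m \<alpha>' \<beta>' (Suc k * n)" by (simp add: n_def algebra_simps)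
    then show ?case using fin Suc.prems by simp
  qed (simp add: len)
  from this[of p] show ?thesis using len by (simp add: al_output_def n_def)
qed

lemma card_bool_lists_le: "card {l :: bool list. length l \<le> s} \<le> 4 ^ s"
proof -
  have "card {l :: bool list. length l \<le> s} = (\<Sum>i\<le>s. 2 ^ i)"
    using card_lists_length_le[of "UNIV :: bool set" s] by simp
  \<comment> \<open>The sum is 2^(s+1) - 1; the cruder power keeps the final exponent a product and
    is still right for \<open>s = 0\<close>.\<close>
  also have "\<dots> \<le> 4 ^ s"
  proof (induction s)
    case (Suc s)
    have "(2 :: nat) ^ s \<le> 4 ^ s" by (rule power_mono) simp_all
    with Suc show ?case by simp
  qed simp
  finally show ?thesis .
qed

lemma length_mem_after_le:
  assumes "t \<le> p * length \<sigma>"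
  shows "length (mem_after A \<sigma> t) \<le> memory_bits A p \<sigma>"
  unfolding memory_bits_def using assms by (intro Max_ge) auto

lemma memory_lower_bound:
  assumes correct: "\<And>x y. al_output A p (a_items N x @ b_items N y) = diameter (windmill N x y)"
    and bits: "\<And>x y. memory_bits A p (a_items N x @ b_items N y) \<le> s"
  shows "N \<le> 4 * p * s"
proof -
  define L where "L = {l :: bool list. length l \<le> s}"
  define \<tau> where "\<tau> S = transcript A p (a_items N (\<lambda>i. i \<in> S)) (b_items N (\<lambda>i. i \<notin> S))" for S
  have finL: "finite L"
    using finite_lists_length_le[of "UNIV :: bool set" s] by (simp add: L_def)
  \<comment> \<open>An element of \<open>S\<close> outside \<open>T\<close> makes the crossed pair
    intersecting, with diameter at least 10, although its output is that of a disjoint pair. By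
    symmetry, \<open>\<tau>\<close> is injective.\<close>
  have sub: "S \<subseteq> T" if "\<tau> S = \<tau> T" and S: "S \<subseteq> {1..N}" for S T
  proof (rule ccontr)
    assume "\<not> S \<subseteq> T"
    then obtain i where "i \<in> {1..N}" "i \<in> S" "i \<notin> T" using S by blast
    then have "10 \<le> diameter (windmill N (\<lambda>i. i \<in> S) (\<lambda>i. i \<notin> T))"
      by (intro diameter_windmill_ge)
    also have "\<dots> = diameter (windmill N (\<lambda>i. i \<in> S) (\<lambda>i. i \<notin> S))"
      using that(1) unfolding correct[symmetric] \<tau>_def
      by (intro transcript_crossover) (simp_all add: a_items_def b_items_def)
    also have "\<dots> \<le> 9" by (rule diameter_windmill_le) simp
    finally show False by simp
  qed
  have inj: "inj_on \<tau> (Pow {1..N})"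
    by (rule inj_onI) (metis PowD sub subset_antisym)
  have "\<tau> S \<in> {ls. set ls \<subseteq> L \<and> length ls = 2 * p}" for S
  proof -
    let ?\<sigma> = "a_items N (\<lambda>i. i \<in> S) @ b_items N (\<lambda>i. i \<notin> S)"
    have mem: "mem_after A ?\<sigma> t \<in> L" if "t \<le> p * length ?\<sigma>" for t
      using length_mem_after_le[OF that, of A] bits[of "\<lambda>i. i \<in> S" "\<lambda>i. i \<notin> S"]
      by (simp add: L_def)
    have times: "k * length ?\<sigma> + length (a_items N (\<lambda>i. i \<in> S)) \<le> p * length ?\<sigma>"
      "Suc k * length ?\<sigma> \<le> p * length ?\<sigma>" if "k < p" for k
    proof -
      show "Suc k * length ?\<sigma> \<le> p * length ?\<sigma>" using that by (intro mult_right_mono) simp_all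
      then show "k * length ?\<sigma> + length (a_items N (\<lambda>i. i \<in> S)) \<le> p * length ?\<sigma>" by simp
    qed
    have "set (\<tau> S) \<subseteq> L"
      unfolding \<tau>_def transcript_def Let_def set_append set_map
      by (intro Un_least image_subsetI mem times) simp_all
    then show ?thesis by (simp add: \<tau>_def transcript_def Let_def)
  qed
  \<comment> \<open>Pigeonhole: 2^N subsets inject into the possible transcripts.\<close>
  then have "card (Pow {1..N}) \<le> card {ls. set ls \<subseteq> L \<and> length ls = 2 * p}"
    by (intro card_inj_on_le[OF inj] finite_lists_length_eq finL) auto
  also have "\<dots> = card L ^ (2 * p)" by (rule card_lists_length_eq[OF finL])
  also have "\<dots> \<le> (4 ^ s) ^ (2 * p)"
    using card_bool_lists_le by (intro power_mono) (simp_all add: L_def)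
  also have "\<dots> = ((2 ^ 2) ^ s) ^ (2 * p)" by simp
  also have "\<dots> = 2 ^ (4 * p * s)" unfolding power_mult[symmetric] by (simp add: ac_simps)
  finally show ?thesis by (simp add: card_Pow)
qed

theorem theorem21:
  shows "\<exists>c\<^sub>0::real. c\<^sub>0 > 0 \<and> (\<exists>n\<^sub>0::nat.
    \<forall>(F :: nat pair_pre_digraph set) (A :: al_algorithm) (p :: nat).
      (\<forall>G\<in>F. pair_graph G \<and> pverts G \<noteq> {}) \<longrightarrow>
      (\<forall>N\<ge>1. \<forall>x y. windmill N x y \<in> F) \<longrightarrow>
      p \<ge> 1 \<longrightarrow>
      solves_diameter A p F \<longrightarrow>
      (\<forall>n\<ge>n\<^sub>0. (\<exists>N\<ge>1. n = 5 * N + 6) \<longrightarrow>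
        (\<exists>G\<in>F. card (pverts G) = n \<and>
          (\<exists>\<sigma>. al_stream G \<sigma> \<and> real (memory_bits A p \<sigma>) \<ge> c\<^sub>0 * (real n / real p)))))"
\<comment> \<open>44 = 4 * 11: the factor 4 comes from \<open>memory_lower_bound\<close>, and 5N + 6
  \<le> 11N holds for all N \<ge> 1, so the threshold 0 suffices.\<close>
proof (intro exI[of _ "1 / 44"] conjI exI[of _ 0] allI impI)
  fix F :: "nat pair_pre_digraph set" and A :: al_algorithm and p n :: nat
  assume F: "\<forall>N\<ge>1. \<forall>x y. windmill N x y \<in> F" and p: "1 \<le> p" and A: "solves_diameter A p F"
    and "\<exists>N\<ge>1. n = 5 * N + 6"
  then obtain N where N: "1 \<le> N" "n = 5 * N + 6" by blast
  let ?\<sigma> = "\<lambda>x y. a_items N x @ b_items N y"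
  have "\<exists>x y. 1 / 44 * (real n / real p) \<le> real (memory_bits A p (?\<sigma> x y))"
  proof (rule ccontr)
    assume "\<not> ?thesis"
    then have less: "real (memory_bits A p (?\<sigma> x y)) < 1 / 44 * (real n / real p)" for x y
      by (simp add: not_le)
    \<comment> \<open>The largest integer strictly below the bound; positivity of the bound keeps
      \<open>nat\<close> from truncating.\<close>
    define s where "s = nat (\<lceil>1 / 44 * (real n / real p)\<rceil> - 1)"
    have "memory_bits A p (?\<sigma> x y) \<le> s" for x y
      using less[of x y] unfolding s_def by linarith
    moreover have "al_output A p (?\<sigma> x y) = diameter (windmill N x y)" for x y
      using A F N(1) al_stream_windmill unfolding solves_diameter_def by blast
    ultimately have "N \<le> 4 * p * s" by (intro memory_lower_bound)
    then have "real N \<le> 4 * real p * real s"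
      by (metis of_nat_le_iff of_nat_mult of_nat_numeral)
    moreover have "0 < 1 / 44 * (real n / real p)" using N p by simp
    then have "real s < 1 / 44 * (real n / real p)" unfolding s_def by linarith
    then have "44 * real p * real s < real n" using p by (simp add: field_simps)
    ultimately show False using N by simp
  qed
  then obtain x y where "1 / 44 * (real n / real p) \<le> real (memory_bits A p (?\<sigma> x y))" by blast
  with F N al_stream_windmill[of N x y]
  show "\<exists>G\<in>F. card (pverts G) = n \<and>
      (\<exists>\<sigma>. al_stream G \<sigma> \<and> real (memory_bits A p \<sigma>) \<ge> 1 / 44 * (real n / real p))"
    by (intro bexI[of _ "windmill N x y"]) (auto simp: pverts_windmill)
qed simp

end
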